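(* Let $a$ be an integer, and let $h(t,v)$ be a formal power series in $t$ with complex coefficients depending on the parameter $v$. Let the polynomials $\beta_n^{(a)}(x,v)$ in $x$ be defined by $$\left(\frac{t}{e^t-1}\right)^a e^{xt+h(t,v)}=\sum_{n=0}^\infty \beta_n^{(a)}(x,v)\frac{t^n}{n!}.$$ Then for all $n\in\mathbb{N}_0$, $$\frac{\partial}{\partial x}\beta_n^{(a)}(x,v)=n\,\beta_{n-1}^{(a)}(x,v),$$ where for $n=0$ the right-hand side is read as $0$.
   Context: $\mathbb{N}_0=\{0,1,2,\dots\}$. The generating function is a formal power series in $t$, with $e^{h(t,v)}=\sum_{n\ge0}h(t,v)^n/n!$ (the constant term of $h$ in $t$ is exponentiated as a complex number). *)

theory Defs
  imports "HOL-Analysis.Analysis"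
begin

text \<open>
  The library's \<open>fps_compose (fps_exp 1) f\<close> truncates each coefficient and hence is the exponential
  of \<open>f\<close> only if \<open>f\<close> has no constant term. Here every coefficient of \<open>\<Sum>n. f ^ n / n!\<close> is an
  infinite series of complex numbers; by \<open>exp_fps_sums\<close> below it always converges.
\<close>

definition exp_fps :: "complex fps \<Rightarrow> complex fps" where
  "exp_fps f = Abs_fps (\<lambda>k. \<Sum>n. fps_nth (f ^ n) k / fact n)"

lemma exp_fps_sums_aux:
  fixes f :: "complex fps"
  defines "g \<equiv> f - fps_const (fps_nth f 0)"
  shows "(\<lambda>n. fps_nth (f ^ n) k / fact n) sums
           fps_nth (fps_const (exp (fps_nth f 0)) * (fps_exp 1 oo g)) k"
proof -
  define c where "c = fps_nth f 0"
  define A where "A = (\<lambda>i. c ^ i / fact i)"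
  define B where "B = (\<lambda>j. fps_nth (g ^ j) k / fact j)"
  have g0: "fps_nth g 0 = 0"
    by (simp add: g_def)
  have B0: "B j = 0" if "j \<notin> {..k}" for j
    using that g0 by (simp add: B_def startsby_zero_power_prefix)
  have sA: "A sums exp c"
    using exp_converges[of c] by (simp add: A_def scaleR_conv_of_real field_simps)
  have nA: "summable (\<lambda>i. norm (A i))"
    using summable_norm_exp[of c] by (simp add: A_def norm_divide norm_power norm_mult field_simps)
  have sB: "B sums (\<Sum>j\<le>k. B j)"
    by (rule sums_finite) (use B0 in auto)
  have nB: "summable (\<lambda>j. norm (B j))"
    by (rule summable_finite[of "{..k}"]) (use B0 in auto)
  have conv: "fps_nth (f ^ n) k / fact n = (\<Sum>i\<le>n. A i * B (n - i))" for n
  proof -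
    have "f ^ n = (fps_const c + g) ^ n"
      by (simp add: g_def c_def)
    also have "\<dots> = (\<Sum>i\<le>n. of_nat (n choose i) * fps_const c ^ i * g ^ (n - i))"
      by (rule binomial_ring)
    also have "\<dots> = (\<Sum>i\<le>n. fps_const (of_nat (n choose i) * c ^ i) * g ^ (n - i))"
      by (intro sum.cong refl) (simp add: fps_const_power fps_of_nat [symmetric])
    finally have "fps_nth (f ^ n) k = (\<Sum>i\<le>n. of_nat (n choose i) * c ^ i * fps_nth (g ^ (n - i)) k)"
      by (simp add: fps_sum_nth)
    then show ?thesis
      by (auto simp: A_def B_def sum_divide_distrib binomial_fact intro!: sum.cong)
  qed
  have "(\<lambda>n. \<Sum>i\<le>n. A i * B (n - i)) sums ((\<Sum>i. A i) * (\<Sum>j. B j))"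
    by (rule Cauchy_product_sums[OF nA nB])
  moreover have "(\<Sum>j\<le>k. B j) = fps_nth (fps_exp 1 oo g) k"
    by (simp add: fps_compose_nth B_def atLeast0AtMost)
  ultimately show ?thesis
    using sums_unique[OF sA] sums_unique[OF sB] by (simp add: conv c_def)
qed

lemma exp_fps_sums: "(\<lambda>n. fps_nth (f ^ n) k / fact n) sums fps_nth (exp_fps f) k"
  using exp_fps_sums_aux[of f k] by (simp add: exp_fps_def sums_iff)

lemma exp_fps_eq:
  "exp_fps f = fps_const (exp (fps_nth f 0)) * (fps_exp 1 oo (f - fps_const (fps_nth f 0)))"
  using exp_fps_sums exp_fps_sums_aux by (intro fps_ext) (rule sums_unique2)

lemma exp_fps_X_add:
  "exp_fps (fps_const x * fps_X + f) = fps_exp x * exp_fps f"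
proof -
  define g where "g = f - fps_const (fps_nth f 0)"
  define P where "P = fps_exp 1 oo g"
  define Q where "Q = fps_exp 1 oo (fps_const x * fps_X + g)"
  have P0: "fps_nth P 0 = 1" and Q0: "fps_nth Q 0 = 1"
    by (simp_all add: P_def Q_def)
  have dP: "fps_deriv P = fps_deriv g * P"
    by (simp add: P_def fps_compose_deriv g_def mult.commute)
  have dQ: "fps_deriv Q = (fps_const x + fps_deriv g) * Q"
    by (simp add: Q_def fps_compose_deriv g_def mult.commute)
  have PI: "P * inverse P = 1"
    using P0 by (simp add: inverse_mult_eq_1')
  have "fps_deriv (inverse P) = - fps_deriv P * (inverse P)\<^sup>2"
    using P0 by (intro fps_inverse_deriv) auto
  also have "\<dots> = - fps_deriv g * inverse P * (P * inverse P)"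
    by (simp add: dP power2_eq_square algebra_simps)
  finally have dI: "fps_deriv (inverse P) = - fps_deriv g * inverse P"
    by (simp add: PI)
  have "fps_deriv (Q * inverse P) = fps_const x * (Q * inverse P)"
    by (simp add: dI dQ algebra_simps)
  then have "Q * inverse P = fps_exp x"
    using P0 Q0 by (subst (asm) fps_exp_unique_ODE) simp
  then have "Q = fps_exp x * P"
    using PI by (metis mult.assoc mult.commute mult.right_neutral)
  then show ?thesis
    by (simp add: exp_fps_eq P_def Q_def g_def algebra_simps)
qed

text \<open>
  The library's division of power series cancels the common factor \<open>t\<close>, so the quotient
  \<open>t / (e\<^sup>t - 1)\<close> has constant term 1 and its powers with negative exponent are genuine inverses.
\<close>

lemma todd_fps_nth_0: "fps_nth (fps_X / (fps_exp 1 - 1) :: complex fps) 0 = 1"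
proof -
  have s: "subdegree (fps_exp 1 - 1 :: complex fps) = 1"
    by (rule subdegreeI) auto
  then have "subdegree (1 - fps_exp 1 :: complex fps) = 1"
    by (simp add: subdegree_minus_commute)
  with s show ?thesis
    by (auto simp: fps_divide_def Let_def fps_eq_iff)
qed

lemma beta_poly_ex1:
  fixes a :: int and h :: "'v \<Rightarrow> complex fps"
  shows "\<exists>!\<beta> :: nat \<Rightarrow> 'v \<Rightarrow> complex poly. \<forall>x v.
    (fps_X / (fps_exp 1 - 1)) powi a * exp_fps (fps_const x * fps_X + h v)
      = Abs_fps (\<lambda>n. poly (\<beta> n v) x / fact n)"
proof -
  define C where "C = (\<lambda>v. (fps_X / (fps_exp 1 - 1)) powi a * exp_fps (h v))"
  define \<beta> where "\<beta> = (\<lambda>n v. \<Sum>i\<le>n. monom (fact n * fps_nth (C v) (n - i) / fact i) i)"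
  have eq: "(fps_X / (fps_exp 1 - 1)) powi a * exp_fps (fps_const x * fps_X + h v)
      = Abs_fps (\<lambda>n. poly (\<beta> n v) x / fact n)" for x v
  proof -
    have "(fps_X / (fps_exp 1 - 1)) powi a * exp_fps (fps_const x * fps_X + h v) = fps_exp x * C v"
      by (simp only: C_def exp_fps_X_add mult.left_commute)
    also have "\<dots> = Abs_fps (\<lambda>n. poly (\<beta> n v) x / fact n)"
      by (intro fps_ext) (auto simp: fps_mult_nth \<beta>_def poly_sum poly_monom atLeast0AtMost
        sum_divide_distrib intro!: sum.cong)
    finally show ?thesis .
  qed
  show ?thesis
  proof (rule ex1I[of _ \<beta>])
    show "\<forall>x v. (fps_X / (fps_exp 1 - 1)) powi a * exp_fps (fps_const x * fps_X + h v)
      = Abs_fps (\<lambda>n. poly (\<beta> n v) x / fact n)"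
      using eq by blast
  next
    fix \<gamma> :: "nat \<Rightarrow> 'v \<Rightarrow> complex poly"
    assume g: "\<forall>x v. (fps_X / (fps_exp 1 - 1)) powi a * exp_fps (fps_const x * fps_X + h v)
      = Abs_fps (\<lambda>n. poly (\<gamma> n v) x / fact n)"
    have "poly (\<gamma> n v) x = poly (\<beta> n v) x" for n v x
    proof -
      have "Abs_fps (\<lambda>n. poly (\<gamma> n v) x / fact n) = Abs_fps (\<lambda>n. poly (\<beta> n v) x / fact n)"
        using g eq by metis
      from this[THEN arg_cong, of "\<lambda>F. fps_nth F n"] show ?thesis
        by simp
    qed
    then show "\<gamma> = \<beta>"
      by (intro ext) (simp add: poly_eq_poly_eq_iff[symmetric] fun_eq_iff)
  qed
qed

end

theory Submission
  imports Defs
begin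

text \<open>
  The generating function is \<open>e\<^bsup>xt\<^esup>\<close> times a series not depending on \<open>x\<close>. Hence the coefficient of
  \<open>x\<^sup>i\<close> in \<open>\<beta>\<^sub>n\<close> is \<open>n choose i\<close> times the value of \<open>\<beta>\<^sub>n\<^sub>-\<^sub>i\<close> at \<open>0\<close>, and the claim becomes the
  absorption identity \<open>(i + 1) (n choose (i + 1)) = n ((n - 1) choose i)\<close>.
\<close>

lemma coeff_Appell:
  fixes p :: "nat \<Rightarrow> 'a :: field_char_0 poly"
  assumes gen: "\<And>x. Abs_fps (\<lambda>n. poly (p n) x / fact n) = fps_exp x * C"
  shows "coeff (p n) i = of_nat (n choose i) * poly (p (n - i)) 0"
proof -
  \<comment> \<open>At \<open>x = 0\<close> the factor \<open>fps_exp x\<close> is 1, so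
    \<open>C\<close> is the exponential generating function of the values at 0.\<close>
  have C: "fps_nth C k = poly (p k) 0 / fact k" for k
    using gen[of 0, THEN arg_cong, of "\<lambda>F. fps_nth F k"] by simp
  have "p n = (\<Sum>j\<le>n. monom (of_nat (n choose j) * poly (p (n - j)) 0) j)"
  \<comment> \<open>In characteristic 0 the field is infinite, so polynomials agreeing at every
    point are equal.\<close>
  proof (rule poly_ext)
    fix x
    have "poly (p n) x / fact n = (\<Sum>j\<le>n. x ^ j / fact j * (poly (p (n - j)) 0 / fact (n - j)))"
      using gen[of x, THEN arg_cong, of "\<lambda>F. fps_nth F n"]
      by (simp add: fps_mult_nth C atLeast0AtMost)
    then have "poly (p n) x
        = fact n * (\<Sum>j\<le>n. x ^ j / fact j * (poly (p (n - j)) 0 / fact (n - j)))"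
      by (simp add: field_simps)
    also have "\<dots> = poly (\<Sum>j\<le>n. monom (of_nat (n choose j) * poly (p (n - j)) 0) j) x"
      by (auto simp: poly_sum poly_monom sum_distrib_left binomial_fact intro!: sum.cong)
    finally show "poly (p n) x = \<dots>" .
  qed
  then have "coeff (p n) i = coeff (\<Sum>j\<le>n. monom (of_nat (n choose j) * poly (p (n - j)) 0) j) i"
    by (rule arg_cong)
  \<comment> \<open>For \<open>i > n\<close> both sides vanish, as \<open>n choose i = 0\<close>;
    the truncated \<open>n - i\<close> does no harm.\<close>
  also have "\<dots> = of_nat (n choose i) * poly (p (n - i)) 0"
    by (cases "i \<le> n") (simp_all add: coeff_sum)
  finally show ?thesis .
qed

lemma pderiv_Appell:
  fixes p :: "nat \<Rightarrow> 'a :: field_char_0 poly"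
  assumes gen: "\<And>x. Abs_fps (\<lambda>n. poly (p n) x / fact n) = fps_exp x * C"
  shows "pderiv (p n) = (if n = 0 then 0 else of_nat n * p (n - 1))"
proof (cases n)
  case 0
  then show ?thesis
    by (intro poly_eqI) (simp add: coeff_pderiv coeff_Appell[OF gen])
next
  case (Suc m)
  have "coeff (pderiv (p n)) i = coeff (of_nat n * p m) i" for i
  proof -
    \<comment> \<open>\<open>Suc m - Suc i = m - i\<close> holds even for \<open>i > m\<close>, so
      no case split is needed.\<close>
    have "coeff (pderiv (p n)) i = of_nat (Suc i * (Suc m choose Suc i)) * poly (p (m - i)) 0"
      by (simp add: Suc coeff_pderiv coeff_Appell[OF gen] algebra_simps del: binomial_Suc_Suc)
    also have "\<dots> = of_nat (n * (m choose i)) * poly (p (m - i)) 0"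
      by (simp only: Suc_times_binomial Suc)
    also have "\<dots> = coeff (of_nat n * p m) i"
      by (simp add: of_nat_poly coeff_Appell[OF gen, of m] mult.assoc)
    finally show ?thesis .
  qed
  then show ?thesis
    by (simp add: Suc poly_eq_iff)
qed

theorem theorem3:
  fixes a :: int
    and h :: "'v \<Rightarrow> complex fps"
    and \<beta> :: "nat \<Rightarrow> 'v \<Rightarrow> complex poly"
  assumes "\<And>x v. (fps_X / (fps_exp 1 - 1)) powi a * exp_fps (fps_const x * fps_X + h v)
             = Abs_fps (\<lambda>n. poly (\<beta> n v) x / fact n)"
  shows "\<And>n v. pderiv (\<beta> n v) = (if n = 0 then 0 else of_nat n * \<beta> (n - 1) v)"
proof -
  fix n v
  \<comment> \<open>With \<open>v\<close> fixed, the factor after \<open>fps_exp x\<close> is free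
    of \<open>x\<close> and serves as \<open>C\<close>.\<close>
  have "Abs_fps (\<lambda>n. poly (\<beta> n v) x / fact n)
      = fps_exp x * ((fps_X / (fps_exp 1 - 1)) powi a * exp_fps (h v))" for x
    by (simp only: assms[symmetric] exp_fps_X_add mult.left_commute)
  then show "pderiv (\<beta> n v) = (if n = 0 then 0 else of_nat n * \<beta> (n - 1) v)"
    by (rule pderiv_Appell)
qed

end
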